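(* For every $n\ge 2$, the closure $\overline{D_n}$ of $D_n$ in $\mathbb{R}$ is a finite union of compact intervals.
   Context: For $n\ge1$, $D_n=\left\{\prod_{p\mid b}\left(1-\frac{1}{p^n}\right): b\in\mathbb{Z}\right\}$, where the product is over primes dividing $b$ (for $b=0$ it is the product over all primes, equal to $1/\zeta(n)$). *)

theory Defs
  imports "HOL-Analysis.Analysis" "HOL-Computational_Algebra.Primes"
begin

text \<open>
  The product over the primes dividing \<open>b\<close> is taken as the limit of the products over the primes
  up to \<open>N\<close>. For \<open>b \<noteq> 0\<close> this sequence is eventually constant; for \<open>b = 0\<close> it gives the Euler
  product over all primes. Unlike \<^const>\<open>prodinf\<close>, the limit also has the right value (zero) when
  \<open>n = 1\<close> and \<open>b = 0\<close>, where the product diverges to zero.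
\<close>

definition prime_div_prod :: "nat \<Rightarrow> int \<Rightarrow> real" where
  "prime_div_prod n b =
     lim (\<lambda>N. \<Prod>p | prime p \<and> p \<le> N \<and> int p dvd b. 1 - 1 / real p ^ n)"

definition D :: "nat \<Rightarrow> real set" where
  "D n = range (prime_div_prod n)"

lemma prime_div_prod_LIMSEQ:
  "(\<lambda>N. \<Prod>p | prime p \<and> p \<le> N \<and> int p dvd b. 1 - 1 / real p ^ n) \<longlonglongrightarrow> prime_div_prod n b"
proof -
  let ?S = "\<lambda>N. {p. prime p \<and> p \<le> N \<and> int p dvd b}"
  let ?f = "\<lambda>p::nat. 1 - 1 / real p ^ n"
  have fin: "finite (?S N)" for N
    by (rule finite_subset[of _ "{..N}"]) auto
  have f: "0 \<le> ?f p \<and> ?f p \<le> 1" if "prime p" for p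
    using prime_ge_2_nat[OF that] by (simp add: divide_simps)
  have dec: "decseq (\<lambda>N. prod ?f (?S N))"
  proof (rule decseq_SucI)
    fix N
    have "prod ?f (?S (Suc N)) = prod ?f (?S N) * prod ?f (?S (Suc N) - ?S N)"
      by (subst mult.commute, rule prod.subset_diff) (auto simp: fin)
    also have "\<dots> \<le> prod ?f (?S N) * 1"
      by (intro mult_left_mono prod_le_1 prod_nonneg) (use f in auto)
    finally show "prod ?f (?S (Suc N)) \<le> prod ?f (?S N)" by simp
  qed
  have "convergent (\<lambda>N. prod ?f (?S N))"
    by (rule decseq_convergent[OF dec, of 0])
       (auto intro!: prod_nonneg f[THEN conjunct1] simp: convergent_def)
  then show ?thesis
    unfolding prime_div_prod_def by (simp add: convergent_LIMSEQ_iff)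
qed

lemma prime_div_prod_nonzero:
  assumes "b \<noteq> 0"
  shows "prime_div_prod n b = (\<Prod>p | prime p \<and> int p dvd b. 1 - 1 / real p ^ n)"
proof -
  have bound: "p \<le> nat \<bar>b\<bar>" if "int p dvd b" for p
    using dvd_imp_le_int[OF assms that] by simp
  have "eventually (\<lambda>N. (\<Prod>p | prime p \<and> p \<le> N \<and> int p dvd b. 1 - 1 / real p ^ n) =
          (\<Prod>p | prime p \<and> int p dvd b. 1 - 1 / real p ^ n)) sequentially"
    using eventually_ge_at_top[of "nat \<bar>b\<bar>"]
    by eventually_elim (rule prod.cong, use bound in \<open>auto intro: order_trans\<close>)
  from tendsto_eventually[OF this] show ?thesis
    using LIMSEQ_unique prime_div_prod_LIMSEQ by blast
qed

end

theory Submission imports Defs "HOL-Real_Asymp.Real_Asymp" begin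

text \<open>
  Write \<open>z N\<close> for the Euler product over the primes above \<open>N\<close>. As in Kakeya's criterion for
  subsums of a series, the products over finite sets of primes above \<open>P\<close> are dense in
  \<open>[z P, 1]\<close> as soon as \<open>z p \<le> 1 - 1 / p ^ n\<close> for all \<open>p \<ge> P\<close>. This holds for large \<open>p\<close>
  because the number of primes in \<open>(p, 4 p]\<close> tends to infinity. Choosing the divisors
  up to \<open>P\<close> freely, \<open>D n\<close> is, up to the point \<open>1 / zeta n\<close>, a finite union of scaled copies
  of such a dense set.
\<close>

lemma finite_primes_le [simp, intro]: "finite {p::nat. prime p \<and> p \<le> N}"
  by (rule finite_subset[of _ "{..N}"]) auto

lemma finite_primes_between [simp, intro]: "finite {p::nat. prime p \<and> M < p \<and> p \<le> N}"
  by (rule finite_subset[of _ "{..N}"]) auto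

subsection \<open>A Chebyshev-type lower bound\<close>

lemma prod_primes_dvd:
  fixes A :: "nat set"
  assumes "finite A" "\<And>p. p \<in> A \<Longrightarrow> prime p" "\<And>p. p \<in> A \<Longrightarrow> p dvd m"
  shows "\<Prod>A dvd m"
  using assms
proof (induction A rule: finite_induct)
  case (insert p A)
  have "coprime p (\<Prod>A)"
    by (intro prod_coprime_right primes_coprime) (use insert in auto)
  moreover have "p dvd m" "\<Prod>A dvd m"
    using insert.prems by (auto intro!: insert.IH)
  ultimately have "p * \<Prod>A dvd m"
    by (intro divides_mult)
  then show ?case
    by (simp only: prod.insert[OF insert.hyps])
qed simp

text \<open>Such a \<open>p\<close> divides \<open>fact n\<close> but neither \<open>fact k\<close>
  nor \<open>fact (n - k)\<close>.\<close>

lemma prime_dvd_choose: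
  assumes "prime p" "k < p" "n - k < p" "p \<le> n"
  shows "p dvd (n choose k)"
proof -
  have "fact n = fact k * fact (n - k) * (n choose k)"
    using assms binomial_fact_lemma[of k n] by simp
  then have "p dvd fact k * fact (n - k) * (n choose k)"
    using assms prime_dvd_fact_iff by metis
  then show ?thesis
    using assms by (simp add: prime_dvd_mult_iff prime_dvd_fact_iff)
qed

text \<open>By symmetry, the coefficients with index at most \<open>m\<close> make up half of the
  row sum \<open>2 ^ (2 * m + 1)\<close>.\<close>

lemma central_binomial_odd_le: "(2 * m + 1 choose m) \<le> 4 ^ m"
proof -
  have "(2 * m + 1 choose m) \<le> (\<Sum>k\<le>m. 2 * m + 1 choose k)"
    by (intro member_le_sum) auto
  also have "\<dots> = 4 ^ m"
    by (subst binomial_r_part_sum) (simp add: power_mult)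
  finally show ?thesis .
qed

text \<open>Strong induction after Erdos: an even \<open>n > 2\<close> adds no prime; for odd
  \<open>n = 2 * m + 1\<close> the primes above \<open>m + 1\<close> all divide one binomial
  coefficient.\<close>

lemma prod_primes_le: "\<Prod>{p::nat. prime p \<and> p \<le> n} \<le> 4 ^ n"
proof (induction n rule: less_induct)
  case (less n)
  consider "n < 2" | "n = 2" | "n > 2" "even n" | "n > 2" "odd n" by linarith
  then show ?case
  proof cases
    case 1
    then have "{p::nat. prime p \<and> p \<le> n} = {}"
      by (auto dest!: prime_ge_2_nat)
    then show ?thesis by (simp only: prod.empty) simp
  next
    case 2
    then have "{p::nat. prime p \<and> p \<le> n} = {2}"
      by (auto dest: prime_ge_2_nat)
    then show ?thesis by (simp only: prod.insert finite.emptyI) (simp add: 2)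
  next
    case 3
    then have "\<not> prime n" using prime_odd_nat by blast
    then have "{p. prime p \<and> p \<le> n} = {p. prime p \<and> p \<le> n - 1}"
      by (auto simp: le_eq_less_or_eq)
    also have "\<Prod>\<dots> \<le> 4 ^ (n - 1)" using 3 by (intro less) auto
    also have "\<dots> \<le> 4 ^ n" by (intro power_increasing) auto
    finally show ?thesis .
  next
    case 4
    then obtain m where n: "n = 2 * m + 1" by (auto elim: oddE)
    with 4 have "m \<ge> 1" by simp
    \<comment> \<open>The cut is at \<open>m + 1 = n - m\<close>, so that each prime in
      \<open>?B\<close> exceeds both lower factorials' arguments.\<close>
    let ?A = "{p. prime p \<and> p \<le> m + 1}" and ?B = "{p. prime p \<and> m + 1 < p \<and> p \<le> n}"
    have "{p. prime p \<and> p \<le> n} = ?A \<union> ?B" using n by auto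
    moreover have "?A \<inter> ?B = {}" by auto
    ultimately have "\<Prod>{p. prime p \<and> p \<le> n} = \<Prod>?A * \<Prod>?B"
      by (simp add: prod.union_disjoint)
    also have "\<Prod>?A \<le> 4 ^ (m + 1)" using \<open>m \<ge> 1\<close> n by (intro less) auto
    also have "\<Prod>?B dvd (n choose m)"
      by (rule prod_primes_dvd[OF finite_primes_between]) (auto simp: n intro!: prime_dvd_choose)
    then have "\<Prod>?B \<le> (n choose m)" by (rule dvd_imp_le) (simp add: n)
    also have "\<dots> \<le> 4 ^ m" unfolding n by (rule central_binomial_odd_le)
    also have "4 ^ (m + 1) * 4 ^ m = (4 ^ n :: nat)"
      by (simp add: n power_add[symmetric] mult_2)
    finally show ?thesis by simp
  qed
qed

section \<open>Common multiples of 1, ..., n and binomial coefficients\<close>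

text \<open>Recurrence of Leibniz's harmonic triangle, whose entries are reciprocals of
  \<open>k * (n choose k)\<close>. Clearing denominators reduces it to the absorption
  identity.\<close>

lemma leibniz_triangle:
  assumes "1 \<le> k" "k \<le> n"
  shows "1 / real (Suc k * (Suc n choose Suc k)) =
           1 / real (k * (n choose k)) - 1 / real (k * (Suc n choose k))"
proof -
  define a b where "a = real (n choose k)" and "b = real (Suc n choose k)"
  have ab: "a > 0" "b > 0" using assms by (auto simp: a_def b_def)
  have e1: "real (Suc k * (Suc n choose Suc k)) = real (Suc n) * a"
    unfolding a_def of_nat_mult[symmetric] Suc_times_binomial ..
  have "(Suc n - k) * (Suc n choose k) = Suc n * (n choose k)"
    using binomial_absorb_comp[of "Suc n" k] by simp
  then have "(real (Suc n) - real k) * b = real (Suc n) * a"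
    using assms unfolding a_def b_def
    by (metis of_nat_mult of_nat_diff le_SucI)
  then have *: "b * real (Suc n) - b * real k = real (Suc n) * a" by (simp add: algebra_simps)
  have "1 / (real k * a) - 1 / (real k * b) = 1 / (real (Suc n) * a)"
    using ab assms * by (simp add: divide_simps) (simp add: algebra_simps)
  with e1 show ?thesis by (simp add: a_def b_def)
qed

text \<open>Induction on the column \<open>k\<close>, for all rows at once: \<open>M\<close> times
  an entry of column \<open>Suc k\<close> of the harmonic triangle is a difference of two such
  integers from column \<open>k\<close>. Column 1 is the hypothesis on \<open>M\<close>.\<close>

lemma binomial_dvd_common_multiple:
  assumes "1 \<le> k" "k \<le> n" "\<And>i. 1 \<le> i \<Longrightarrow> i \<le> n \<Longrightarrow> i dvd M"
  shows "k * (n choose k) dvd M"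
proof -
  have "real M / real (k * (n choose k)) \<in> \<int>"
    using assms
  proof (induction k arbitrary: n rule: nat_induct_at_least)
    case base
    then have "n dvd M" by simp
    then show ?case by (metis Ints_of_nat mult_1 binomial_1 One_nat_def of_nat_of_nat_div)
  next
    case (Suc k n)
    then obtain n' where n: "n = Suc n'" by (cases n) auto
    have "real M / real (k * (n' choose k)) \<in> \<int>" "real M / real (k * (n choose k)) \<in> \<int>"
      using Suc by (auto simp: n simp del: binomial_Suc_Suc intro!: Suc.IH)
    then have "real M * (1 / real (k * (n' choose k)) - 1 / real (k * (n choose k))) \<in> \<int>"
      by (simp add: right_diff_distrib)
    also have "1 / real (k * (n' choose k)) - 1 / real (k * (n choose k)) =
        1 / real (Suc k * (n choose Suc k))"
      unfolding n by (rule leibniz_triangle[symmetric]) (use Suc n in auto)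
    finally show ?case by (simp only: times_divide_eq_right mult_1_right)
  qed
  then obtain j where "real M / real (k * (n choose k)) = of_int j" by (auto elim: Ints_cases)
  then have "real_of_int (int M) = real_of_int (int (k * (n choose k)) * j)"
    using assms by (simp add: field_simps)
  then have "int M = int (k * (n choose k)) * j" by (simp only: of_int_eq_iff)
  then show ?thesis by (metis dvd_triv_left int_dvd_int_iff)
qed

text \<open>The exact power of \<open>p\<close> in \<open>i\<close> is at most \<open>i\<close>,
  hence at most \<open>n\<close>, so its exponent is bounded by \<open>e p\<close>.\<close>

lemma common_multiple_prime_powers:
  fixes e :: "nat \<Rightarrow> nat"
  assumes e: "\<And>p k. prime p \<Longrightarrow> p ^ k \<le> n \<Longrightarrow> k \<le> e p" and "1 \<le> i" "i \<le> n"
  shows "i dvd (\<Prod>p | prime p \<and> p \<le> n. p ^ e p)"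
proof -
  have "i = (\<Prod>p\<in>prime_factors i. p ^ multiplicity p i)"
    using prime_factorization_nat[of i] assms by simp
  also have "\<dots> dvd (\<Prod>p\<in>prime_factors i. p ^ e p)"
  proof (intro prod_dvd_prod le_imp_power_dvd e)
    fix p assume "p \<in> prime_factors i"
    then show "prime p" by auto
    show "p ^ multiplicity p i \<le> n"
      using multiplicity_dvd[of p i] assms by (meson dvd_imp_le order_trans less_le_trans zero_less_one)
  qed
  also have "\<dots> dvd (\<Prod>p | prime p \<and> p \<le> n. p ^ e p)"
  proof (rule prod_dvd_prod_subset)
    show "finite {p. prime p \<and> p \<le> n}" by (rule finite_primes_le)
    show "prime_factors i \<subseteq> {p. prime p \<and> p \<le> n}"
      using assms by (auto simp: prime_factors_dvd dest!: dvd_imp_le)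
  qed
  finally show ?thesis .
qed

text \<open>The central binomial coefficient of \<open>N = 4 x\<close> divides the product of the maximal prime
  powers \<open>p ^ e p \<le> N\<close>. Here \<open>p \<le> x\<close> contributes at most \<open>p\<close>, or at most \<open>N\<close> for the few
  \<open>p \<le> sqrt N\<close>, so by \<open>prod_primes_le\<close> the primes in \<open>(x, 4 x]\<close> have to account for the rest.\<close>

lemma power_le_card_primes:
  assumes "x \<ge> (1::nat)"
  defines "K \<equiv> card {p. prime p \<and> x < p \<and> p \<le> 4 * x}"
  shows "16 ^ x \<le> 2 * 4 ^ x * (4 * real x) powr (2 * sqrt x + K)"
proof -
  define N where "N = 4 * x"
  have "\<exists>e. p ^ e \<le> N \<and> N < p ^ Suc e" if "prime p" for p
    using ex_power_ivl1[of p N] prime_ge_2_nat[OF that] assms by (auto simp: N_def)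
  then obtain e where e: "\<And>p. prime p \<Longrightarrow> p ^ e p \<le> N" "\<And>p. prime p \<Longrightarrow> N < p ^ Suc (e p)"
    by metis
  let ?P = "\<lambda>n. {p::nat. prime p \<and> p \<le> n}" and ?Q = "{p. prime p \<and> x < p \<and> p \<le> 4 * x}"
  let ?R = "{p \<in> ?P x. p\<^sup>2 \<le> N}"
  have le: "p ^ e p \<le> p * (if p\<^sup>2 \<le> N then N else 1)" if "prime p" for p
  proof (cases "p\<^sup>2 \<le> N")
    case True
    then show ?thesis using e(1)[OF that] prime_gt_0_nat[OF that]
      by (simp add: order_trans[of _ "1 * N"])
  next
    case False
    \<comment> \<open>Above \<open>sqrt N\<close> the maximal power has exponent at most 1.\<close>
    then have "p ^ e p < p ^ 2" using e(1)[OF that] by linarith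
    then have "e p \<le> 1" using prime_gt_1_nat[OF that] by simp
    then have "p ^ e p \<le> p ^ 1" by (intro power_increasing) (use prime_ge_1_nat[OF that] in auto)
    then show ?thesis using False by simp
  qed
  define M where "M = (\<Prod>p\<in>?P N. p ^ e p)"
  have "?P N = ?P x \<union> ?Q" "?P x \<inter> ?Q = {}" by (auto simp: N_def)
  then have "M = (\<Prod>p\<in>?P x. p ^ e p) * (\<Prod>p\<in>?Q. p ^ e p)"
    unfolding M_def by (simp add: prod.union_disjoint)
  also have "\<dots> \<le> (\<Prod>p\<in>?P x. p * (if p\<^sup>2 \<le> N then N else 1)) * (\<Prod>p\<in>?Q. N)"
    by (intro mult_mono prod_mono) (use le e in auto)
  also have "\<dots> = \<Prod>(?P x) * N ^ card ?R * N ^ K"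
    unfolding prod.distrib by (simp add: K_def prod.inter_filter[symmetric])
  also have "\<dots> \<le> 4 ^ x * N ^ card ?R * N ^ K"
    by (intro mult_right_mono prod_primes_le) auto
  finally have M_le: "M \<le> 4 ^ x * (N ^ card ?R * N ^ K)" by simp
  \<comment> \<open>Counting all integers up to \<open>sqrt N = 2 * sqrt x\<close> is enough
    here.\<close>
  have cardR: "real (card ?R) \<le> 2 * sqrt x"
  proof -
    have "?R \<subseteq> {1..nat \<lfloor>2 * sqrt x\<rfloor>}"
    proof
      fix p assume "p \<in> ?R"
      then have p: "prime p" "p\<^sup>2 \<le> 4 * x" by (auto simp: N_def)
      then have "(real p)\<^sup>2 \<le> 4 * real x"
        by (metis of_nat_le_iff of_nat_mult of_nat_numeral of_nat_power)
      then have "real p \<le> sqrt (4 * real x)" by (rule real_le_rsqrt)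
      then have "real p \<le> 2 * sqrt x" by (simp add: real_sqrt_mult)
      then show "p \<in> {1..nat \<lfloor>2 * sqrt x\<rfloor>}" using prime_ge_1_nat[OF p(1)] by (simp add: le_nat_floor)
    qed
    then have "card ?R \<le> card {1..nat \<lfloor>2 * sqrt x\<rfloor>}" by (intro card_mono) auto
    then have "card ?R \<le> nat \<lfloor>2 * sqrt x\<rfloor>" by simp
    also have "real \<dots> \<le> 2 * sqrt x" by simp
    finally show ?thesis by simp
  qed
  \<comment> \<open>The extra factor \<open>2 * x\<close> cancels the denominator of the lower bound
    for the central binomial coefficient.\<close>
  have "2 * x * (N choose (2 * x)) dvd M"
    unfolding M_def
  proof (intro binomial_dvd_common_multiple common_multiple_prime_powers)
    fix p k :: nat assume "prime p" "p ^ k \<le> N"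
    then have "p ^ k < p ^ Suc (e p)" using e(2)[of p] by linarith
    then show "k \<le> e p" using prime_gt_1_nat[OF \<open>prime p\<close>] by (simp del: power_Suc)
  qed (use assms in \<open>auto simp: N_def\<close>)
  moreover have "M > 0" unfolding M_def by (intro prod_pos) (auto simp: prime_gt_0_nat)
  ultimately have "2 * x * (N choose (2 * x)) \<le> M" by (rule dvd_imp_le)
  then have "real (2 * x) * real (N choose (2 * x)) \<le> real M"
    by (metis of_nat_le_iff of_nat_mult)
  moreover have "4 ^ (2 * x) / (2 * real (2 * x)) \<le> real (N choose (2 * x))"
    using central_binomial_lower_bound[of "2 * x"] assms by (simp add: N_def)
  then have "4 ^ (2 * x) / 2 \<le> real (2 * x) * real (N choose (2 * x))"
    using assms by (simp add: field_simps)
  ultimately have "4 ^ (2 * x) / 2 \<le> real M" by linarith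
  also have "\<dots> \<le> real (4 ^ x * (N ^ card ?R * N ^ K))" using M_le by (simp only: of_nat_le_iff)
  also have "\<dots> = 4 ^ x * real N powr (real (card ?R) + K)"
    using assms by (simp add: powr_add powr_realpow N_def)
  also have "\<dots> \<le> 4 ^ x * real N powr (2 * sqrt x + K)"
    using cardR assms by (intro mult_left_mono powr_mono) (auto simp: N_def)
  finally show ?thesis by (simp add: N_def power_mult)
qed

text \<open>With fewer than \<open>k\<close> primes the previous inequality would bound
  \<open>4 ^ x\<close> by \<open>2 * (4 * x) powr (2 * sqrt x + k)\<close>, whose logarithm is only
  of order \<open>sqrt x * ln x\<close>.\<close>

lemma eventually_card_primes_ge:
  "\<forall>\<^sub>F x in sequentially. k \<le> card {p::nat. prime p \<and> x < p \<and> p \<le> 4 * x}"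
proof -
  have "\<forall>\<^sub>F x in at_top. 2 * 4 powr x * (4 * x) powr (2 * sqrt x + real k) < 16 powr (x::real)"
    by real_asymp
  then have "\<forall>\<^sub>F x in sequentially.
      2 * 4 powr real x * (4 * real x) powr (2 * sqrt (real x) + real k) < 16 powr real x"
    by (rule eventually_compose_filterlim) (rule filterlim_real_sequentially)
  then show ?thesis
    using eventually_ge_at_top[of 1]
  proof eventually_elim
    case (elim x)
    show ?case
    proof (rule ccontr)
      assume "\<not> ?thesis"
      then have "(4 * real x) powr (2 * sqrt x + card {p::nat. prime p \<and> x < p \<and> p \<le> 4 * x})
          \<le> (4 * real x) powr (2 * sqrt x + k)"
        using elim by (intro powr_mono) auto
      then have "2 * 4 ^ x * (4 * real x) powr (2 * sqrt x + card {p::nat. prime p \<and> x < p \<and> p \<le> 4 * x})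
          \<le> 2 * 4 ^ x * (4 * real x) powr (2 * sqrt x + k)"
        by (intro mult_left_mono) auto
      with elim power_le_card_primes[of x] show False by (simp add: powr_realpow)
    qed
  qed
qed

subsection \<open>Euler products\<close>

definition euler_prod :: "nat \<Rightarrow> nat \<Rightarrow> real" where
  "euler_prod n N = (\<Prod>p | prime p \<and> p \<le> N. 1 - 1 / real p ^ n)"

text \<open>The product over all primes above \<open>N\<close>, taken as a quotient so that its
  limit in \<open>N\<close> follows from that of \<open>euler_prod\<close>.\<close>

definition euler_tail :: "nat \<Rightarrow> nat \<Rightarrow> real" where
  "euler_tail n N = prime_div_prod n 0 / euler_prod n N"

text \<open>What the prime divisors above \<open>N\<close> of a nonzero integer can
  contribute.\<close>

definition finite_prods :: "nat \<Rightarrow> nat \<Rightarrow> real set" where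
  "finite_prods n N = {\<Prod>p\<in>S. 1 - 1 / real p ^ n |S. finite S \<and> S \<subseteq> {p. prime p \<and> N < p}}"

lemma euler_factor_bounds:
  assumes "n \<ge> 1" "p \<ge> (2::nat)"
  shows "0 < 1 - 1 / real p ^ n" "1 - 1 / real p ^ n < 1"
proof -
  have "1 < real p ^ n" using assms by (intro one_less_power) auto
  then show "0 < 1 - 1 / real p ^ n" by (simp add: divide_simps)
  show "1 - 1 / real p ^ n < 1" using assms by simp
qed

lemma prod_euler_factor_bounds:
  assumes "n \<ge> 1" "\<And>p. p \<in> S \<Longrightarrow> prime p"
  shows "0 < (\<Prod>p\<in>S. 1 - 1 / real p ^ n)" "(\<Prod>p\<in>S. 1 - 1 / real p ^ n) \<le> 1"
  using euler_factor_bounds[OF assms(1) prime_ge_2_nat[OF assms(2)]]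
  by (auto intro!: prod_pos prod_le_1 simp: less_imp_le)

lemma euler_prod_pos: "n \<ge> 1 \<Longrightarrow> 0 < euler_prod n N"
  unfolding euler_prod_def by (rule prod_euler_factor_bounds) auto

lemma euler_prod_Suc:
  "euler_prod n (Suc N) = euler_prod n N * (if prime (Suc N) then 1 - 1 / real (Suc N) ^ n else 1)"
proof (cases "prime (Suc N)")
  case True
  then have "{p. prime p \<and> p \<le> Suc N} = insert (Suc N) {p. prime p \<and> p \<le> N}"
    by (auto simp: le_Suc_eq)
  then show ?thesis using True by (simp add: euler_prod_def mult.commute)
next
  case False
  then have "{p. prime p \<and> p \<le> Suc N} = {p. prime p \<and> p \<le> N}"
    by (auto simp: le_Suc_eq)
  then show ?thesis using False by (simp add: euler_prod_def)
qed

lemma euler_prod_split: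
  assumes "M \<le> N"
  shows "euler_prod n N = euler_prod n M * (\<Prod>p | prime p \<and> M < p \<and> p \<le> N. 1 - 1 / real p ^ n)"
proof -
  have "{p. prime p \<and> p \<le> N} = {p. prime p \<and> p \<le> M} \<union> {p. prime p \<and> M < p \<and> p \<le> N}"
    using assms by auto
  then show ?thesis
    unfolding euler_prod_def by (simp add: prod.union_disjoint[symmetric] disjoint_iff)
qed

lemma euler_prod_antimono:
  assumes "n \<ge> 1" "M \<le> N"
  shows "euler_prod n N \<le> euler_prod n M"
  unfolding euler_prod_split[OF assms(2)]
  by (intro mult_left_le prod_euler_factor_bounds less_imp_le[OF euler_prod_pos] assms(1)) auto

lemma euler_prod_LIMSEQ: "euler_prod n \<longlonglongrightarrow> prime_div_prod n 0"
  using prime_div_prod_LIMSEQ[of n 0] unfolding euler_prod_def[abs_def] by simp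

lemma euler_prod_ge: 
  assumes "n \<ge> 1"
  shows "prime_div_prod n 0 \<le> euler_prod n N"
  by (rule decseq_ge[OF _ euler_prod_LIMSEQ]) (auto intro!: decseq_SucI euler_prod_antimono assms)

text \<open>The factors over all integers \<open>2 \<le> k \<le> N\<close> telescope: their product is \<open>(N + 1) / (2 N)\<close>.\<close>

lemma euler_prod_ge_half:
  assumes "n \<ge> 2"
  shows "euler_prod n (Suc N) \<ge> 1 / 2 + 1 / (2 * real (Suc N))"
proof (induction N)
  case 0
  have "{p::nat. prime p \<and> p \<le> Suc 0} = {}" by (auto dest!: prime_ge_2_nat)
  then have "euler_prod n (Suc 0) = 1" unfolding euler_prod_def by (simp only: prod.empty)
  then show ?case by simp
next
  case (Suc N)
  define m where "m = real (Suc N)"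
  have m: "m \<ge> 1" by (simp add: m_def)
  let ?f = "if prime (Suc (Suc N)) then 1 - 1 / real (Suc (Suc N)) ^ n else 1"
  have "1 / (m + 1) ^ n \<le> 1 / (m + 1) ^ 2"
    using m assms by (intro divide_left_mono power_increasing) auto
  then have f: "?f \<ge> 1 - 1 / (m + 1)\<^sup>2" using m by (auto simp: m_def add.commute)
  \<comment> \<open>The telescoping step: \<open>(m + 1) / (2 * m)\<close> times
    \<open>m * (m + 2) / (m + 1)\<^sup>2\<close>.\<close>
  have "1 / 2 + 1 / (2 * (m + 1)) = (1 / 2 + 1 / (2 * m)) * (1 - 1 / (m + 1)\<^sup>2)"
    using m by (simp add: divide_simps power2_eq_square) (simp add: algebra_simps)
  also have "\<dots> \<le> euler_prod n (Suc N) * ?f"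
  proof (intro mult_mono f)
    show "1 / 2 + 1 / (2 * m) \<le> euler_prod n (Suc N)" using Suc by (simp add: m_def)
    show "0 \<le> 1 - 1 / (m + 1)\<^sup>2" using m by (simp add: divide_simps power2_eq_square algebra_simps)
    show "0 \<le> euler_prod n (Suc N)" using assms by (intro less_imp_le euler_prod_pos) auto
  qed
  also have "\<dots> = euler_prod n (Suc (Suc N))" by (rule euler_prod_Suc[symmetric])
  finally show ?case by (simp add: m_def add.commute)
qed

text \<open>This is where \<open>n \<ge> 2\<close> enters; for \<open>n = 1\<close> the limit is
  zero and tails carry no information.\<close>

lemma euler_limit_pos:
  assumes "n \<ge> 2"
  shows "0 < prime_div_prod n 0"
proof -
  have "1 / 2 \<le> prime_div_prod n 0"
  proof (rule LIMSEQ_le_const[OF LIMSEQ_Suc[OF euler_prod_LIMSEQ]], intro exI allI impI)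
    fix N
    have "0 \<le> 1 / (2 * real (Suc N))" by simp
    then show "1 / 2 \<le> euler_prod n (Suc N)" using euler_prod_ge_half[OF assms, of N] by linarith
  qed
  then show ?thesis by simp
qed

lemma euler_tail_pos: "n \<ge> 2 \<Longrightarrow> 0 < euler_tail n N"
  by (simp add: euler_tail_def euler_limit_pos euler_prod_pos)

lemma euler_tail_LIMSEQ:
  assumes "n \<ge> 2"
  shows "euler_tail n \<longlonglongrightarrow> 1"
proof -
  have "(\<lambda>N. prime_div_prod n 0 / euler_prod n N) \<longlonglongrightarrow> prime_div_prod n 0 / prime_div_prod n 0"
    using euler_limit_pos[OF assms] by (intro tendsto_intros euler_prod_LIMSEQ) auto
  then show ?thesis using euler_limit_pos[OF assms] by (simp add: euler_tail_def[abs_def])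
qed

lemma euler_tail_Suc:
  assumes "n \<ge> 2"
  shows "euler_tail n N = (if prime (Suc N) then 1 - 1 / real (Suc N) ^ n else 1) * euler_tail n (Suc N)"
proof -
  have "(if prime (Suc N) then 1 - 1 / real (Suc N) ^ n else 1) > 0"
    using assms euler_factor_bounds[of n "Suc N"] prime_ge_2_nat[of "Suc N"] by auto
  then show ?thesis unfolding euler_tail_def euler_prod_Suc by simp
qed

section \<open>Comparing tails with single factors\<close>

text \<open>Further primes only shrink the product: enlarge \<open>S\<close> to all primes in an
  interval \<open>(M, N]\<close>, then pass to the limit.\<close>

lemma euler_tail_le_prod:
  assumes "n \<ge> 2" "finite S" "S \<subseteq> {p. prime p \<and> M < p}"
  shows "euler_tail n M \<le> (\<Prod>p\<in>S. 1 - 1 / real p ^ n)"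
proof -
  obtain N0 where "\<forall>p\<in>S. p \<le> N0" using assms(2) finite_nat_set_iff_bounded_le by auto
  define N where "N = max M N0"
  have S: "S \<subseteq> {p. prime p \<and> M < p \<and> p \<le> N}" and "M \<le> N"
    using assms(3) \<open>\<forall>p\<in>S. p \<le> N0\<close> by (auto simp: N_def max_def)
  let ?g = "\<lambda>p::nat. 1 - 1 / real p ^ n"
  have "prime_div_prod n 0 \<le> euler_prod n N" using assms by (intro euler_prod_ge) auto
  also have "\<dots> = euler_prod n M * prod ?g {p. prime p \<and> M < p \<and> p \<le> N}"
    by (rule euler_prod_split) fact
  finally have "euler_tail n M \<le> prod ?g {p. prime p \<and> M < p \<and> p \<le> N}"
    unfolding euler_tail_def using euler_prod_pos[of n M] assms by (simp add: field_simps)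
  also have "\<dots> = prod ?g ({p. prime p \<and> M < p \<and> p \<le> N} - S) * prod ?g S"
    by (rule prod.subset_diff[OF S]) auto
  also have "\<dots> \<le> prod ?g S"
    using prod_euler_factor_bounds[of n "{p. prime p \<and> M < p \<and> p \<le> N} - S"]
      prod_euler_factor_bounds[of n S] assms S
    by (intro mult_left_le_one_le) (auto intro!: less_imp_le)
  finally show ?thesis .
qed

text \<open>The \<open>k\<close> primes in \<open>(p, 4 p]\<close> contribute to the tail a factor at most
  \<open>(1 - u) ^ k \<le> 1 / (1 + k u)\<close> with \<open>u = 1 / (4 p) ^ n\<close>, and \<open>k u \<ge> 2 / p ^ n\<close> once
  \<open>k \<ge> 2 * 4 ^ n\<close>.\<close>

lemma eventually_euler_tail_le:
  assumes "n \<ge> 2"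
  shows "\<forall>\<^sub>F p in sequentially. euler_tail n p \<le> 1 - 1 / real p ^ n"
  using eventually_card_primes_ge[of "2 * 4 ^ n"] eventually_ge_at_top[of 2]
proof eventually_elim
  case (elim p)
  define S where "S = {q. prime q \<and> p < q \<and> q \<le> 4 * p}"
  define u v k where "u = 1 / (4 * real p) ^ n" and "v = 1 / real p ^ n" and "k = card S"
  have S: "finite S" "S \<subseteq> {q. prime q \<and> p < q}" by (auto simp: S_def)
  have "(2::real) ^ 1 \<le> 2 ^ n" using assms by (intro power_increasing) auto
  also have "\<dots> \<le> real p ^ n" using elim by (intro power_mono) auto
  finally have v: "0 < v" "v \<le> 1 / 2" using elim by (simp_all add: v_def divide_simps)
  have uv: "4 ^ n * u = v" by (simp add: u_def v_def power_mult_distrib)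
  then have u: "0 < u" "u \<le> v" using v elim by (auto simp: u_def v_def intro!: divide_left_mono power_mono)
  have "2 * v = real (2 * 4 ^ n) * u" by (simp add: uv[symmetric])
  also have "\<dots> \<le> real k * u" using elim u by (intro mult_right_mono) (auto simp: k_def S_def simp del: of_nat_mult of_nat_power)
  finally have k: "2 * v \<le> real k * u" .
  have "euler_tail n p \<le> (\<Prod>q\<in>S. 1 - 1 / real q ^ n)"
    by (rule euler_tail_le_prod[OF assms S])
  also have "\<dots> \<le> (\<Prod>q\<in>S. 1 - u)"
  proof (intro prod_mono conjI)
    fix q assume q: "q \<in> S"
    then show "0 \<le> 1 - 1 / real q ^ n"
      using euler_factor_bounds(1)[of n q] prime_ge_2_nat[of q] assms by (auto simp: S_def)
    have "real q \<le> 4 * real p" "0 < q" using q by (auto simp: S_def)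
    then show "1 - 1 / real q ^ n \<le> 1 - u"
      unfolding u_def by (intro diff_left_mono divide_left_mono power_mono) auto
  qed
  also have "\<dots> = (1 - u) ^ k" by (simp add: k_def)
  also have "\<dots> \<le> 1 / (1 + real k * u)"
  proof -
    \<comment> \<open>Bernoulli bounds \<open>1 + k * u\<close> by \<open>(1 + u) ^ k\<close>, and
      \<open>(1 - u) * (1 + u) \<le> 1\<close>.\<close>
    have "(1 - u) ^ k * (1 + real k * u) \<le> (1 - u) ^ k * (1 + u) ^ k"
      using u v Bernoulli_inequality[of u k] by (intro mult_left_mono) auto
    also have "\<dots> = (1 - u * u) ^ k" by (simp add: power_mult_distrib[symmetric] algebra_simps)
    also have "\<dots> \<le> 1" using u v by (intro power_le_one) (auto intro: mult_le_one)
    finally show ?thesis using u by (simp add: pos_le_divide_eq add_pos_nonneg)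
  qed
  also have "\<dots> \<le> 1 / (1 + 2 * v)"
    using k v by (intro divide_left_mono) (auto intro!: mult_pos_pos add_pos_nonneg)
  also have "\<dots> \<le> 1 - v"
  proof -
    \<comment> \<open>Here \<open>v \<le> 1 / 2\<close> is used; the product below is
      \<open>1 + v * (1 - 2 * v)\<close>.\<close>
    have "0 \<le> v * (1 - 2 * v)" using v by simp
    then have "1 \<le> (1 - v) * (1 + 2 * v)" by (simp add: algebra_simps)
    then show ?thesis using v by (simp add: pos_divide_le_eq)
  qed
  finally show ?case by (simp add: v_def)
qed

section \<open>Density of the finite products in an interval\<close>

text \<open>Greedy expansion: a prime is used as soon as the product stays above \<open>t\<close>; otherwise the
  hypothesis guarantees that the remaining primes still suffice to get down to \<open>t\<close>.\<close>

lemma greedy_prod: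
  assumes n: "n \<ge> 2" and P: "\<And>p. p \<ge> P \<Longrightarrow> euler_tail n p \<le> 1 - 1 / real p ^ n"
    and t: "euler_tail n P \<le> t" "t \<le> 1" and "P \<le> N"
  shows "\<exists>c\<in>finite_prods n P. t \<le> c \<and> c * euler_tail n N \<le> t"
proof -
  \<comment> \<open>Invariant: the current product is at least \<open>t\<close>, and multiplying in
    all remaining primes would bring it to \<open>t\<close> or below.\<close>
  have "\<exists>S. finite S \<and> S \<subseteq> {p. prime p \<and> P < p \<and> p \<le> N} \<and> t \<le> (\<Prod>p\<in>S. 1 - 1 / real p ^ n) \<and>
      (\<Prod>p\<in>S. 1 - 1 / real p ^ n) * euler_tail n N \<le> t"
    using \<open>P \<le> N\<close>
  proof (induction N rule: dec_induct)
    case base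
    then show ?case using t by (intro exI[of _ "{}"]) auto
  next
    case (step N)
    then obtain S where S: "finite S" "S \<subseteq> {p. prime p \<and> P < p \<and> p \<le> N}"
      "t \<le> (\<Prod>p\<in>S. 1 - 1 / real p ^ n)" "(\<Prod>p\<in>S. 1 - 1 / real p ^ n) * euler_tail n N \<le> t" by blast
    define c g where "c = (\<Prod>p\<in>S. 1 - 1 / real p ^ n)" and "g = 1 - 1 / real (Suc N) ^ n"
    show ?case
    proof (cases "prime (Suc N)")
      case False
      then show ?thesis using S euler_tail_Suc[OF n, of N] by (intro exI[of _ S]) auto
    next
      case True
      then have tail: "euler_tail n N = g * euler_tail n (Suc N)"
        by (simp add: euler_tail_Suc[OF n, of N] g_def)
      show ?thesis
      proof (cases "t \<le> c * g")
        case True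
        have "Suc N \<notin> S" using S by auto
        then have "(\<Prod>p\<in>insert (Suc N) S. 1 - 1 / real p ^ n) = c * g"
          using S(1) by (simp add: c_def g_def mult.commute)
        then show ?thesis
          \<comment> \<open>Taking the prime moves \<open>g\<close> from the tail into
            \<open>c\<close>, leaving \<open>c * euler_tail n N\<close> unchanged.\<close>
          using S True \<open>prime (Suc N)\<close> tail \<open>P \<le> N\<close>
          by (intro exI[of _ "insert (Suc N) S"]) (auto simp: c_def)
      next
        case False
        have "c > 0" unfolding c_def using n S by (intro prod_euler_factor_bounds) auto
        \<comment> \<open>Skipping the prime is safe: the later primes alone reach
          \<open>c * g\<close> or lower, and \<open>c * g < t\<close>.\<close>
        then have "c * euler_tail n (Suc N) \<le> c * g"
          using P[of "Suc N"] \<open>P \<le> N\<close> by (intro mult_left_mono) (auto simp: g_def)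
        then show ?thesis using S False by (intro exI[of _ S]) (auto simp: c_def)
      qed
    qed
  qed
  then obtain S where "finite S" "S \<subseteq> {p. prime p \<and> P < p \<and> p \<le> N}"
    "t \<le> (\<Prod>p\<in>S. 1 - 1 / real p ^ n)" "(\<Prod>p\<in>S. 1 - 1 / real p ^ n) * euler_tail n N \<le> t"
    by blast
  moreover from this have "(\<Prod>p\<in>S. 1 - 1 / real p ^ n) \<in> finite_prods n P"
    unfolding finite_prods_def by blast
  ultimately show ?thesis by blast
qed

lemma closure_finite_prods:
  assumes n: "n \<ge> 2" and P: "\<And>p. p \<ge> P \<Longrightarrow> euler_tail n p \<le> 1 - 1 / real p ^ n"
  shows "closure (finite_prods n P) = {euler_tail n P..1}"
proof
  show "closure (finite_prods n P) \<subseteq> {euler_tail n P..1}"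
    using n by (intro closure_minimal)
      (auto simp: finite_prods_def intro!: euler_tail_le_prod prod_euler_factor_bounds)
next
  show "{euler_tail n P..1} \<subseteq> closure (finite_prods n P)"
  proof
    fix t assume "t \<in> {euler_tail n P..1}"
    then have "\<exists>c\<in>finite_prods n P. t \<le> c \<and> c * euler_tail n N \<le> t" if "P \<le> N" for N
      using greedy_prod[OF n P] that by auto
    then obtain c where c: "\<And>N. P \<le> N \<Longrightarrow> c N \<in> finite_prods n P"
      "\<And>N. P \<le> N \<Longrightarrow> t \<le> c N" "\<And>N. P \<le> N \<Longrightarrow> c N * euler_tail n N \<le> t"
      by metis
    \<comment> \<open>The greedy products lie between \<open>t\<close> and
      \<open>t / euler_tail n N\<close>, and the tails tend to 1.\<close>
    have "c \<longlonglongrightarrow> t"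
    proof (rule tendsto_sandwich)
      show "\<forall>\<^sub>F N in sequentially. t \<le> c N"
        using eventually_ge_at_top[of P] by eventually_elim (rule c)
      show "\<forall>\<^sub>F N in sequentially. c N \<le> t / euler_tail n N"
        using eventually_ge_at_top[of P]
        by eventually_elim (simp add: c pos_le_divide_eq euler_tail_pos[OF n])
      have "(\<lambda>N. t / euler_tail n N) \<longlonglongrightarrow> t / 1"
        by (intro tendsto_intros euler_tail_LIMSEQ n) auto
      then show "(\<lambda>N. t / euler_tail n N) \<longlonglongrightarrow> t" by simp
    qed auto
    then have "(\<lambda>N. c (N + P)) \<longlonglongrightarrow> t" by (rule LIMSEQ_ignore_initial_segment)
    then show "t \<in> closure (finite_prods n P)"
      unfolding closure_sequential by (intro exI[of _ "\<lambda>N. c (N + P)"]) (auto intro: c)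
  qed
qed

section \<open>Decomposition of \<open>D n\<close> and its closure\<close>

lemma closure_UN_finite: "finite I \<Longrightarrow> closure (\<Union>i\<in>I. A i) = (\<Union>i\<in>I. closure (A i))"
  by (induction I rule: finite_induct) auto

text \<open>The prime divisors of a nonzero \<open>b\<close> form an arbitrary finite set of primes;
  split it at \<open>P\<close>. The case \<open>b = 0\<close> uses infinitely many primes and gives
  the separate point.\<close>

lemma D_eq:
  "D n = insert (prime_div_prod n 0)
    (\<Union>S\<in>Pow {p. prime p \<and> p \<le> P}. (*) (\<Prod>p\<in>S. 1 - 1 / real p ^ n) ` finite_prods n P)"
  (is "_ = insert _ (\<Union>S\<in>?I. ?h S)")
proof
  let ?g = "\<lambda>p::nat. 1 - 1 / real p ^ n"
  show "D n \<subseteq> insert (prime_div_prod n 0) (\<Union>S\<in>?I. ?h S)"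
  proof
    fix x assume "x \<in> D n"
    then obtain b where x: "x = prime_div_prod n b" by (auto simp: D_def)
    show "x \<in> insert (prime_div_prod n 0) (\<Union>S\<in>?I. ?h S)"
    proof (cases "b = 0")
      case False
      define A where "A = {p. prime p \<and> int p dvd b \<and> p \<le> P}"
      define B where "B = {p. prime p \<and> int p dvd b \<and> P < p}"
      have "p \<le> nat \<bar>b\<bar>" if "int p dvd b" for p
        using dvd_imp_le_int[OF False that] by simp
      then have fin: "finite A" "finite B"
        by (auto simp: A_def B_def intro!: finite_subset[of _ "{..nat \<bar>b\<bar>}"])
      have "{p. prime p \<and> int p dvd b} = A \<union> B" "A \<inter> B = {}" by (auto simp: A_def B_def)
      then have "x = prod ?g A * prod ?g B"
        using fin by (simp add: x prime_div_prod_nonzero[OF False] prod.union_disjoint)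
      moreover have "prod ?g B \<in> finite_prods n P"
        using fin by (auto simp: finite_prods_def B_def)
      moreover have "A \<in> ?I" by (auto simp: A_def)
      ultimately show ?thesis by blast
    qed (simp add: x)
  qed
next
  let ?g = "\<lambda>p::nat. 1 - 1 / real p ^ n"
  show "insert (prime_div_prod n 0) (\<Union>S\<in>?I. ?h S) \<subseteq> D n"
  proof (intro insert_subsetI UN_least subsetI)
    show "prime_div_prod n 0 \<in> D n" by (simp add: D_def)
  next
    fix A x assume A: "A \<in> ?I" and "x \<in> ?h A"
    then obtain B where B: "finite B" "B \<subseteq> {p. prime p \<and> P < p}" "x = prod ?g A * prod ?g B"
      by (auto simp: finite_prods_def)
    have fin: "finite A" using A by (auto intro: finite_subset[OF _ finite_primes_le])
    have "p \<le> P" if "p \<in> A" for p using A that by auto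
    moreover have "P < p" if "p \<in> B" for p using B that by auto
    ultimately have "A \<inter> B = {}" using not_less by blast
    then have x: "x = prod ?g (A \<union> B)" using fin B by (simp add: prod.union_disjoint)
    \<comment> \<open>A squarefree integer with exactly the chosen prime divisors.\<close>
    define b where "b = \<Prod>(A \<union> B)"
    have pr: "prime p" if "p \<in> A \<union> B" for p using A B that by auto
    then have "0 \<notin> A \<union> B" using not_prime_0 by blast
    then have "b \<noteq> 0" using fin B(1) by (simp add: b_def)
    have "{p. prime p \<and> int p dvd int b} = A \<union> B"
    proof -
      have "p dvd b \<longleftrightarrow> p \<in> A \<union> B" if p: "prime p" for p
      proof -
        have "p dvd b \<longleftrightarrow> (\<exists>q\<in>A \<union> B. p dvd q)"
          unfolding b_def using fin B(1) p by (intro prime_dvd_prod_iff) auto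
        also have "\<dots> \<longleftrightarrow> p \<in> A \<union> B" using pr primes_dvd_imp_eq[OF p] by (metis dvd_refl)
        finally show ?thesis .
      qed
      then show ?thesis using pr by auto
    qed
    then have "prime_div_prod n (int b) = x"
      using \<open>b \<noteq> 0\<close> by (simp add: prime_div_prod_nonzero x)
    then show "x \<in> D n" by (auto simp: D_def)
  qed
qed

theorem theorem5p4:
  fixes n :: nat
  assumes "n \<ge> 2"
  shows "\<exists>\<I> :: real set set. finite \<I> \<and> (\<forall>I\<in>\<I>. is_interval I \<and> compact I) \<and> closure (D n) = \<Union>\<I>"
proof -
  obtain P where P: "\<And>p. p \<ge> P \<Longrightarrow> euler_tail n p \<le> 1 - 1 / real p ^ n"
    using eventually_euler_tail_le[OF assms] unfolding eventually_sequentially by blast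
  let ?I = "Pow {p. prime p \<and> p \<le> P}"
  let ?c = "\<lambda>S. \<Prod>p\<in>S. 1 - 1 / real p ^ n"
  let ?J = "\<lambda>S. {?c S * euler_tail n P..?c S}"
  \<comment> \<open>The point from \<open>b = 0\<close> counts as a degenerate interval; each choice
    \<open>S\<close> of primes up to \<open>P\<close> gives one scaled copy of
    \<open>{euler_tail n P..1}\<close>.\<close>
  let ?F = "insert {prime_div_prod n 0} (?J ` ?I)"
  have J: "closure ((*) (?c S) ` finite_prods n P) = ?J S" if "S \<in> ?I" for S
  proof -
    have "?c S > 0" using that assms by (intro prod_euler_factor_bounds) auto
    then show ?thesis
      \<comment> \<open>Scaling commutes with closure, and a positive factor keeps the order of the
        endpoints.\<close>
      using closure_scaleR[of "?c S" "finite_prods n P", symmetric]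
      by (simp add: closure_finite_prods[OF assms P] image_mult_atLeastAtMost)
  qed
  have "closure (D n) = insert (prime_div_prod n 0) (\<Union>S\<in>?I. closure ((*) (?c S) ` finite_prods n P))"
    unfolding D_eq[of n P] closure_insert by (simp add: closure_UN_finite)
  also have "\<dots> = \<Union>?F" using J by simp
  finally have "closure (D n) = \<Union>?F" .
  moreover have "\<forall>I\<in>?F. is_interval I \<and> compact I"
    using is_interval_cc[of "prime_div_prod n 0" "prime_div_prod n 0"] by auto
  ultimately show ?thesis by (intro exI[of _ ?F] conjI) auto
qed

end
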